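(* Let $\rho=\sum_{i=1}^kq_i\rho_i$ be a piecewise continuous probability measure in mixture form on $(E_X,\mathfrak B)$, with reference measure $\mu=\sum_{i=1}^k\mu_i$, such that $H_\mu(\rho)$ is finite. Let $H(X|Y)=\sum_{i=1}^kq_iH_{\mu_i}(\rho_i)$ and $H(Y)=-\sum_{i=1}^kq_i\ln q_i$. Let $A^{(n)}_{\delta'}\subset W^{(n)}_{\delta'}(\pi_*\rho)\subset E_Y^n$ ($\delta'>0$, $n\in\mathbb N$) be sets such that for any $\epsilon>0$ one has $(\pi_*\rho)^{\otimes n}(A^{(n)}_{\delta'})\ge1-\epsilon$ for all sufficiently large $n$. For $\delta,\delta'>0$ and $\mathbf y\in A^{(n)}_{\delta'}$ let $T^{(n)}_{\delta,\delta'}(\mathbf y)=(\pi^{\times n})^{-1}(\mathbf y)\cap W^{(n)}_\delta(\rho)$. Set $\boldsymbol\delta=(\delta,\delta')$. For a fixed $\epsilon>0$, let $B^{(n)}_\epsilon$ denote the subset of $A^{(n)}_{\delta'}$ made of the sequences $\mathbf y$ such that $$\frac1n\ln\mu^{\otimes n}\big(T^{(n)}_{\delta,\delta'}(\mathbf y)\big)>H(X|Y)-\epsilon+\delta+\delta'.$$ Then $$\limsup_{\|\boldsymbol\delta\|\to0}\ \limsup_{n\to\infty}\frac1n\ln|B^{(n)}_\epsilon|=\lim_{\delta'\to0}\ \lim_{n\to\infty}\frac1n\ln|A^{(n)}_{\delta'}|=H(Y).$$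
   Context: $\mu\llcorner A$ denotes the restricted measure $B\mapsto\mu(A\cap B)$. A measure $\rho$ on $(E_X,\mathfrak B)$ is piecewise continuous if for some integer $k\ge1$ there are pairwise disjoint sets $E_1,\dots,E_k\in\mathfrak B$ and $\sigma$-finite measures $\mu_1,\dots,\mu_k$ on $(E_X,\mathfrak B)$ such that (1) $\mu_i=\mu_i\llcorner E_i$; (2) $\rho(E_i)>0$ for all $i$; (3) $\rho(E_X\setminus\bigcup_iE_i)=0$; (4) $\rho\llcorner E_i\ll\mu_i$. It is assumed that $E_X=\bigcup_iE_i$. Mixture form of a probability $\rho$: $q_i=\rho(E_i)$, $\rho_i=(\rho\llcorner E_i)/q_i$. Put $E_Y=\{1,\dots,k\}$, let $\pi:E_X\to E_Y$ map $E_i$ to $i$, and let $\pi^{\times n}:E_X^n\to E_Y^n$ be the componentwise map; $\pi_*\rho$ has probability mass function $i\mapsto q_i$. For a $\sigma$-finite measure $\nu$ and a probability $\sigma\ll\nu$ with a fixed version $g$ of $d\sigma/d\nu$: $H_\nu(\sigma)=-\int g\ln g\,d\nu$, and the weakly typical set $W^{(n)}_\delta(\sigma)$ is the set of $(x_1,\dots,x_n)$ with $|-\frac1n\ln\prod_{i=1}^ng(x_i)-H_\nu(\sigma)|\le\delta$. For $\rho$ the reference measure is $\mu$; for $\pi_*\rho$ it is the counting measure on $E_Y$.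
   Formalization: The inner limit over n of (1/n) ln|A| need not exist for fixed δ' (A may alternate between typical sets of widths δ' and δ'/2), so the formal statement instead says that both its liminf and its limsup over n tend to H(Y) as δ'→0. *)

theory Defs
  imports "HOL-Probability.Probability"
begin

(* Natural logarithm with ln 0 = -infinity, in contrast to the library's ln (0::real) = 0.
   The difference matters for empty sets, null sets, and points of vanishing density. *)
definition eln :: "ennreal \<Rightarrow> ereal" where
  "eln x = (if x = 0 then - \<infinity> else if x = \<infinity> then \<infinity> else ereal (ln (enn2real x)))"

(* B \<mapsto> M (A \<inter> B) on the whole space of M, for A measurable (see emeasure_restricted);
   restrict_space would shrink the space. *)
definition restr_measure :: "'a measure \<Rightarrow> 'a set \<Rightarrow> 'a measure" where
  "restr_measure M A = density M (indicator A)"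

(* The first argument only provides the underlying measurable space. *)
definition sum_measure :: "'a measure \<Rightarrow> 'i set \<Rightarrow> ('i \<Rightarrow> 'a measure) \<Rightarrow> 'a measure" where
  "sum_measure M I m = measure_of (space M) (sets M) (\<lambda>B. \<Sum>i\<in>I. emeasure (m i) B)"

lemma space_sum_measure [simp]: "space (sum_measure M I m) = space M"
  by (simp add: sum_measure_def)

lemma sets_sum_measure [simp, measurable_cong]: "sets (sum_measure M I m) = sets M"
  by (simp add: sum_measure_def)

lemma emeasure_sum_measure:
  fixes M :: "'a measure"
  assumes "\<And>i. i \<in> I \<Longrightarrow> sets (m i) = sets M" "B \<in> sets M"
  shows "emeasure (sum_measure M I m) B = (\<Sum>i\<in>I. emeasure (m i) B)"
proof (rule emeasure_measure_of[OF sum_measure_def])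
  show "sets M \<subseteq> Pow (space M)" by (rule sets.space_closed)
  show "positive (sets (sum_measure M I m)) (\<lambda>B. \<Sum>i\<in>I. emeasure (m i) B)"
    by (simp add: positive_def)
  show "countably_additive (sets (sum_measure M I m)) (\<lambda>B. \<Sum>i\<in>I. emeasure (m i) B)"
  proof (rule countably_additiveI)
    fix F :: "nat \<Rightarrow> 'a set"
    assume F: "range F \<subseteq> sets (sum_measure M I m)" "disjoint_family F"
    have "(\<Sum>j. \<Sum>i\<in>I. emeasure (m i) (F j)) = (\<Sum>i\<in>I. \<Sum>j. emeasure (m i) (F j))"
      by (rule suminf_sum) (rule summableI)
    also have "\<dots> = (\<Sum>i\<in>I. emeasure (m i) (\<Union>j. F j))"
      using F assms(1) by (intro sum.cong refl suminf_emeasure) auto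
    finally show "(\<Sum>j. \<Sum>i\<in>I. emeasure (m i) (F j)) = (\<Sum>i\<in>I. emeasure (m i) (\<Union>j. F j))" .
  qed
qed (use assms in simp)

definition piecewise_continuous_decomp ::
    "'a measure \<Rightarrow> nat \<Rightarrow> (nat \<Rightarrow> 'a set) \<Rightarrow> (nat \<Rightarrow> 'a measure) \<Rightarrow> bool" where
  "piecewise_continuous_decomp \<rho> k E m \<longleftrightarrow>
     1 \<le> k \<and>
     disjoint_family_on E {1..k} \<and>
     (\<forall>i\<in>{1..k}. E i \<in> sets \<rho>) \<and>
     (\<forall>i\<in>{1..k}. sets (m i) = sets \<rho> \<and> sigma_finite_measure (m i)) \<and>
     (\<forall>i\<in>{1..k}. m i = restr_measure (m i) (E i)) \<and>
     (\<forall>i\<in>{1..k}. emeasure \<rho> (E i) > 0) \<and>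
     emeasure \<rho> (space \<rho> - (\<Union>i\<in>{1..k}. E i)) = 0 \<and>
     (\<forall>i\<in>{1..k}. absolutely_continuous (m i) (restr_measure \<rho> (E i)))"

definition weight :: "'a measure \<Rightarrow> (nat \<Rightarrow> 'a set) \<Rightarrow> nat \<Rightarrow> real" where
  "weight \<rho> E i = measure \<rho> (E i)"

(* uniform_measure M A is the conditional measure B \<mapsto> M (A \<inter> B) / M A for any measure M. *)
definition component :: "'a measure \<Rightarrow> (nat \<Rightarrow> 'a set) \<Rightarrow> nat \<Rightarrow> 'a measure" where
  "component \<rho> E i = uniform_measure \<rho> (E i)"

definition label :: "nat \<Rightarrow> (nat \<Rightarrow> 'a set) \<Rightarrow> 'a \<Rightarrow> nat" where
  "label k E x = (THE i. i \<in> {1..k} \<and> x \<in> E i)"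

definition label_measure :: "'a measure \<Rightarrow> nat \<Rightarrow> (nat \<Rightarrow> 'a set) \<Rightarrow> nat measure" where
  "label_measure \<rho> k E = distr \<rho> (count_space {1..k}) (label k E)"

definition density_version :: "'a measure \<Rightarrow> 'a measure \<Rightarrow> ('a \<Rightarrow> real) \<Rightarrow> bool" where
  "density_version \<nu> \<sigma> g \<longleftrightarrow>
     g \<in> borel_measurable \<nu> \<and> (\<forall>x\<in>space \<nu>. 0 \<le> g x) \<and> density \<nu> (\<lambda>x. ennreal (g x)) = \<sigma>"

definition rn_real :: "'a measure \<Rightarrow> 'a measure \<Rightarrow> 'a \<Rightarrow> real" where
  "rn_real \<nu> \<sigma> x = enn2real (RN_deriv \<nu> \<sigma> x)"

(* Here the library's ln 0 = 0 gives the usual convention 0 ln 0 = 0. *)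
definition entropy_wrt :: "'a measure \<Rightarrow> 'a measure \<Rightarrow> real" where
  "entropy_wrt \<nu> \<sigma> = - (\<integral>x. rn_real \<nu> \<sigma> x * ln (rn_real \<nu> \<sigma> x) \<partial>\<nu>)"

(* Finiteness means integrability; the Bochner integral above is 0 otherwise. *)
definition entropy_finite :: "'a measure \<Rightarrow> 'a measure \<Rightarrow> bool" where
  "entropy_finite \<nu> \<sigma> \<longleftrightarrow> integrable \<nu> (\<lambda>x. rn_real \<nu> \<sigma> x * ln (rn_real \<nu> \<sigma> x))"

(* Neither notion depends on the version of the density chosen by RN_deriv. *)
lemma
  assumes "sigma_finite_measure \<nu>" "density_version \<nu> \<sigma> g"
  shows entropy_wrt_version: "entropy_wrt \<nu> \<sigma> = - (\<integral>x. g x * ln (g x) \<partial>\<nu>)"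
    and entropy_finite_version:
      "entropy_finite \<nu> \<sigma> \<longleftrightarrow> integrable \<nu> (\<lambda>x. g x * ln (g x))"
proof -
  interpret sigma_finite_measure \<nu> by fact
  have g: "g \<in> borel_measurable \<nu>" "\<And>x. x \<in> space \<nu> \<Longrightarrow> 0 \<le> g x"
      "density \<nu> (\<lambda>x. ennreal (g x)) = \<sigma>"
    using assms(2) by (auto simp: density_version_def)
  have "AE x in \<nu>. ennreal (g x) = RN_deriv \<nu> \<sigma> x"
    using g by (intro RN_deriv_unique) auto
  then have ae: "AE x in \<nu>. rn_real \<nu> \<sigma> x * ln (rn_real \<nu> \<sigma> x) = g x * ln (g x)"
    by (rule AE_mp, intro AE_I2) (metis enn2real_ennreal g(2) rn_real_def)
  have m: "rn_real \<nu> \<sigma> \<in> borel_measurable \<nu>"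
    unfolding rn_real_def by measurable
  show "entropy_wrt \<nu> \<sigma> = - (\<integral>x. g x * ln (g x) \<partial>\<nu>)"
    unfolding entropy_wrt_def using g m by (subst integral_cong_AE[OF _ _ ae]) auto
  show "entropy_finite \<nu> \<sigma> \<longleftrightarrow> integrable \<nu> (\<lambda>x. g x * ln (g x))"
    unfolding entropy_finite_def using g m by (intro integrable_cong_AE ae) auto
qed

(* Words of length n are the points of the n-fold product, i.e. functions on {..<n} that are
   undefined elsewhere.  The typical set of \<sigma> depends on the version g of its density. *)
definition weakly_typical ::
    "'a measure \<Rightarrow> 'a measure \<Rightarrow> ('a \<Rightarrow> real) \<Rightarrow> nat \<Rightarrow> real \<Rightarrow> (nat \<Rightarrow> 'a) set" where
  "weakly_typical \<nu> \<sigma> g n \<delta> =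
     {x \<in> space (PiM {..<n} (\<lambda>_. \<nu>)).
        \<bar>- (ereal (1 / real n) * eln (ennreal (\<Prod>i<n. g (x i)))) - ereal (entropy_wrt \<nu> \<sigma>)\<bar> \<le> ereal \<delta>}"

definition label_typical :: "'a measure \<Rightarrow> nat \<Rightarrow> (nat \<Rightarrow> 'a set) \<Rightarrow> nat \<Rightarrow> real \<Rightarrow> (nat \<Rightarrow> nat) set" where
  "label_typical \<rho> k E n \<delta>' =
     weakly_typical (count_space {1..k}) (label_measure \<rho> k E) (weight \<rho> E) n \<delta>'"

definition ref_measure :: "'a measure \<Rightarrow> nat \<Rightarrow> (nat \<Rightarrow> 'a measure) \<Rightarrow> 'a measure" where
  "ref_measure \<rho> k m = sum_measure \<rho> {1..k} m"

definition cond_entropy ::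
    "'a measure \<Rightarrow> nat \<Rightarrow> (nat \<Rightarrow> 'a set) \<Rightarrow> (nat \<Rightarrow> 'a measure) \<Rightarrow> real" where
  "cond_entropy \<rho> k E m = (\<Sum>i=1..k. weight \<rho> E i * entropy_wrt (m i) (component \<rho> E i))"

definition label_entropy :: "'a measure \<Rightarrow> nat \<Rightarrow> (nat \<Rightarrow> 'a set) \<Rightarrow> real" where
  "label_entropy \<rho> k E = - (\<Sum>i=1..k. weight \<rho> E i * ln (weight \<rho> E i))"

definition fiber_typical ::
    "'a measure \<Rightarrow> nat \<Rightarrow> (nat \<Rightarrow> 'a set) \<Rightarrow> (nat \<Rightarrow> 'a measure) \<Rightarrow> ('a \<Rightarrow> real) \<Rightarrow>
     nat \<Rightarrow> real \<Rightarrow> (nat \<Rightarrow> nat) \<Rightarrow> (nat \<Rightarrow> 'a) set" where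
  "fiber_typical \<rho> k E m g n \<delta> y =
     {x \<in> space (PiM {..<n} (\<lambda>_. \<rho>)). (\<lambda>i\<in>{..<n}. label k E (x i)) = y}
     \<inter> weakly_typical (ref_measure \<rho> k m) \<rho> g n \<delta>"

definition large_fiber_words ::
    "'a measure \<Rightarrow> nat \<Rightarrow> (nat \<Rightarrow> 'a set) \<Rightarrow> (nat \<Rightarrow> 'a measure) \<Rightarrow> ('a \<Rightarrow> real) \<Rightarrow>
     (real \<Rightarrow> nat \<Rightarrow> (nat \<Rightarrow> nat) set) \<Rightarrow> real \<Rightarrow> real \<Rightarrow> real \<Rightarrow> nat \<Rightarrow> (nat \<Rightarrow> nat) set" where
  "large_fiber_words \<rho> k E m g A \<epsilon> \<delta> \<delta>' n =
     {y \<in> A \<delta>' n.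
        ereal (1 / real n) *
          eln (emeasure (PiM {..<n} (\<lambda>_. ref_measure \<rho> k m)) (fiber_typical \<rho> k E m g n \<delta> y))
        > ereal (cond_entropy \<rho> k E m - \<epsilon> + \<delta> + \<delta>')}"

(* For a fixed \<delta>' this need not converge as n grows along S = A \<delta>' n: A may alternate between
   typical sets of widths \<delta>' and \<delta>' / 2.  The iterated limit is therefore to be read as:
   the liminf and the limsup over n both converge as \<delta>' tends to 0. *)
definition growth_rate :: "nat \<Rightarrow> 'a set \<Rightarrow> ereal" where
  "growth_rate n S = ereal (1 / real n) * eln (of_nat (card S))"

end

theory Submission
  imports Defs "HOL-Real_Asymp.Real_Asymp"
begin

text \<open>The bounds on \<open>|A|\<close> are the usual counting of typical words. For \<open>B\<close>, the chain rule
  \<open>H(\<rho>) = H(Y) + H(X|Y)\<close> together with the density bound on the typical set of \<open>\<rho>\<close> shows that the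
  fibers over \<open>A - B\<close> carry exponentially small mass once \<open>2\<delta> + 2\<delta>' < \<epsilon>\<close>. By asymptotic
  equipartition the fibers over \<open>B\<close> then carry at least half of the mass, so the words of \<open>B\<close> have
  probability at least \<open>1/2\<close>, and each of them has probability at most \<open>exp (- n (H(Y) - \<delta>'))\<close>.\<close>

text \<open>Any set of typical words whose probability stays away from 0 already has growth rate
  close to \<open>HY\<close>: a constant factor disappears after taking \<open>1 / n\<close> times
  the logarithm. Hence the same counting argument serves \<open>A\<close> and the words with large
  fibers, and the real work is to bound the probability of the latter from below by a constant. The
  mass over the small fibers is a product of three factors: at most
  \<open>exp (n (HY + \<delta>'))\<close> words, a volume of at most
  \<open>exp (n (H(X|Y) - \<epsilon> + \<delta> + \<delta>'))\<close> for each, and a density of at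
  most \<open>exp (- n (HX - \<delta>))\<close>. The chain rule cancels every entropy, and since
  \<open>\<epsilon>\<close> is fixed while \<open>\<delta>\<close> and \<open>\<delta>'\<close>
  shrink, the remaining exponent becomes negative. Two obstacles shape the details. Finite entropy
  only makes \<open>ln g\<close> integrable under \<open>\<rho>\<close>, so equipartition has to
  rest on a weak law with a first moment. And \<open>A\<close> need not have a growth rate for fixed
  \<open>\<delta>'\<close>, so its liminf and limsup over \<open>n\<close> are squeezed
  separately.\<close>

section \<open>Weak law of large numbers and densities on finite products\<close>

text \<open>The joint law of all coordinates is the product measure itself and each marginal is
  \<open>M\<close>, so the joint law is the product of the marginals; composing with
  \<open>f\<close> keeps independence.\<close>

lemma (in prob_space) indep_vars_PiM_coordinates:
  assumes "I \<noteq> {}" "f \<in> borel_measurable M"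
  shows "prob_space.indep_vars (PiM I (\<lambda>_. M)) (\<lambda>_. borel) (\<lambda>i x. f (x i)) I"
proof -
  interpret P: prob_space "PiM I (\<lambda>_. M)" by (intro prob_space_PiM prob_space_axioms)
  have "distr (PiM I (\<lambda>_. M)) (PiM I (\<lambda>_. M)) (\<lambda>x. \<lambda>i\<in>I. x i)
      = distr (PiM I (\<lambda>_. M)) (PiM I (\<lambda>_. M)) (\<lambda>x. x)"
    by (intro distr_cong) (auto simp: space_PiM)
  also have "\<dots> = PiM I (\<lambda>_. M)"
    by (simp add: distr_id)
  also have "\<dots> = PiM I (\<lambda>i. distr (PiM I (\<lambda>_. M)) M (\<lambda>x. x i))"
    by (intro PiM_cong refl distr_PiM_component[symmetric] prob_space_axioms)
  finally have "P.indep_vars (\<lambda>_. M) (\<lambda>i x. x i) I"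
    using assms by (subst P.indep_vars_iff_distr_eq_PiM') auto
  then show ?thesis
    by (rule P.indep_vars_compose2) (use assms in auto)
qed

lemma (in prob_space)
  fixes f :: "'a \<Rightarrow> real"
  assumes "i \<in> I" "integrable M f"
  shows integrable_PiM_component: "integrable (PiM I (\<lambda>_. M)) (\<lambda>x. f (x i))"
    and integral_PiM_component: "(\<integral>x. f (x i) \<partial>PiM I (\<lambda>_. M)) = expectation f"
proof -
  have d: "distr (PiM I (\<lambda>_. M)) M (\<lambda>x. x i) = M"
    using assms by (intro distr_PiM_component prob_space_axioms)
  have m [measurable]: "(\<lambda>x. x i) \<in> measurable (PiM I (\<lambda>_. M)) M" "f \<in> borel_measurable M"
    using assms by auto
  have "integrable (distr (PiM I (\<lambda>_. M)) M (\<lambda>x. x i)) f"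
    using assms d by simp
  then show "integrable (PiM I (\<lambda>_. M)) (\<lambda>x. f (x i))"
    by (rule integrable_distr[OF m(1)])
  show "(\<integral>x. f (x i) \<partial>PiM I (\<lambda>_. M)) = expectation f"
    using integral_distr[OF m] d by simp
qed

text \<open>Clipping \<open>f\<close> at \<open>-n\<close> and \<open>n\<close> changes nothing at a
  given point once \<open>n\<close> exceeds the absolute value of \<open>f\<close> there, and the
  error is dominated by that absolute value, so dominated convergence applies.\<close>

lemma (in prob_space) bounded_approx_L1:
  fixes f :: "'a \<Rightarrow> real"
  assumes "integrable M f" "0 < e"
  obtains h and K :: real where "h \<in> borel_measurable M" "0 < K" "\<And>x. \<bar>h x\<bar> \<le> K"
    "expectation (\<lambda>x. \<bar>f x - h x\<bar>) < e"
proof -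
  have [measurable]: "f \<in> borel_measurable M" using assms by auto
  define h where "h = (\<lambda>n x. max (- real n) (min (real n) (f x)))"
  have "(\<lambda>n. expectation (\<lambda>x. \<bar>f x - h n x\<bar>)) \<longlonglongrightarrow> expectation (\<lambda>_. 0)"
  proof (rule integral_dominated_convergence[where w = "\<lambda>x. \<bar>f x\<bar>"])
    show "AE x in M. (\<lambda>n. \<bar>f x - h n x\<bar>) \<longlonglongrightarrow> 0"
    proof (intro AE_I2 tendsto_eventually)
      fix x
      obtain N where N: "\<bar>f x\<bar> < real N" using reals_Archimedean2 by blast
      show "\<forall>\<^sub>F n in sequentially. \<bar>f x - h n x\<bar> = 0"
        using eventually_ge_at_top[of N]
        by eventually_elim (use N in \<open>auto simp: h_def\<close>)
    qed
  qed (use assms in \<open>auto simp: h_def\<close>)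
  then have "\<forall>\<^sub>F n in sequentially. expectation (\<lambda>x. \<bar>f x - h n x\<bar>) < e"
    using assms by (intro order_tendstoD) auto
  \<comment> \<open>A positive \<open>n\<close> yields a positive bound \<open>K\<close>;
    Hoeffding's inequality needs ranges of nonzero length.\<close>
  then have "\<forall>\<^sub>F n in sequentially. 0 < n \<and> expectation (\<lambda>x. \<bar>f x - h n x\<bar>) < e"
    using eventually_gt_at_top[of 0] by eventually_elim auto
  then obtain n where n: "0 < n" "expectation (\<lambda>x. \<bar>f x - h n x\<bar>) < e"
    using eventually_happens'[OF sequentially_bot] by blast
  show ?thesis
    by (rule that[of "h n" "real n"]) (use n in \<open>auto simp: h_def\<close>)
qed

text \<open>Truncation costs little in \<open>L\<^sup>1\<close> by Markov's inequality, and the bounded truncated variables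
  concentrate by Hoeffding's inequality; no second moment is required.\<close>

lemma (in prob_space) weak_law_of_large_numbers_PiM:
  fixes f :: "'a \<Rightarrow> real"
  assumes f: "integrable M f" and "0 < d" "0 < e"
  shows "\<forall>\<^sub>F n in sequentially. measure (PiM {..<n} (\<lambda>_. M))
    {x \<in> space (PiM {..<n} (\<lambda>_. M)). \<bar>(\<Sum>i<n. f (x i)) / real n - expectation f\<bar> > d} < e"
proof -
  \<comment> \<open>The deviation \<open>d\<close> is split in three: from \<open>f\<close> to
    \<open>h\<close> along the sample, from the sample mean of \<open>h\<close> to its expectation,
    and between the two expectations. The bound \<open>d / 3\<close> settles the last part;
    \<open>e * d / 6\<close> divided by the Markov threshold \<open>d / 3\<close> gives
    \<open>e / 2\<close> for the first.\<close>
  have "0 < min (d / 3) (e * d / 6)" using assms by simp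
  from bounded_approx_L1[OF f this] obtain h and K :: real
    where hm [measurable]: "h \<in> borel_measurable M" and K: "0 < K" "\<And>x. \<bar>h x\<bar> \<le> K"
      and close: "expectation (\<lambda>x. \<bar>f x - h x\<bar>) < min (d / 3) (e * d / 6)"
    by blast
  have h: "integrable M h"
    by (rule integrable_const_bound[of _ K]) (use K in auto)
  have fm [measurable]: "f \<in> borel_measurable M" using f by auto
  have Ediff: "\<bar>expectation f - expectation h\<bar> \<le> expectation (\<lambda>x. \<bar>f x - h x\<bar>)"
    using integral_abs_bound[of M "\<lambda>x. f x - h x"] f h by simp
  \<comment> \<open>The squared deviation grows like \<open>n\<close> squared and the sum of squared
    ranges only like \<open>n\<close>, so the Hoeffding exponent is linear in
    \<open>n\<close>.\<close>
  have "(\<lambda>n. 2 * exp (- 2 * (real n * (d / 3))\<^sup>2 / (real n * (2 * K)\<^sup>2))) \<longlonglongrightarrow> 0"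
    using K \<open>0 < d\<close> by real_asymp
  then have "\<forall>\<^sub>F n in sequentially. 2 * exp (- 2 * (real n * (d / 3))\<^sup>2 / (real n * (2 * K)\<^sup>2)) < e / 2"
    by (rule order_tendstoD) (use \<open>0 < e\<close> in simp)
  then show ?thesis using eventually_gt_at_top[of 0]
  proof eventually_elim
    case (elim n)
    let ?P = "PiM {..<n} (\<lambda>_. M)"
    interpret P: prob_space ?P by (intro prob_space_PiM prob_space_axioms)
    interpret H: Hoeffding_ineq ?P "{..<n}" "\<lambda>i x. h (x i)" "\<lambda>_. - K" "\<lambda>_. K"
      "\<Sum>i<n. P.expectation (\<lambda>x. h (x i))"
    proof (unfold_locales, goal_cases)
      case 2
      show ?case by (rule indep_vars_PiM_coordinates) (use elim in auto)
    qed (use K in \<open>auto simp: abs_le_iff minus_le_iff\<close>)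
    have mu: "(\<Sum>i<n. P.expectation (\<lambda>x. h (x i))) = real n * expectation h"
      using h by (simp add: integral_PiM_component)
    let ?U = "{x \<in> space ?P. \<bar>(\<Sum>i<n. h (x i)) - real n * expectation h\<bar> \<ge> real n * (d / 3)}"
    let ?V = "{x \<in> space ?P. (\<Sum>i<n. \<bar>f (x i) - h (x i)\<bar>) \<ge> real n * (d / 3)}"
    have "P.prob ?U \<le> 2 * exp (- 2 * (real n * (d / 3))\<^sup>2 / (\<Sum>i<n. (K - - K)\<^sup>2))"
      using \<open>0 < d\<close> K elim by (subst mu[symmetric], intro H.Hoeffding_ineq_abs_ge) auto
    with elim have U: "P.prob ?U < e / 2" by simp
    have int: "integrable ?P (\<lambda>x. \<bar>f (x i) - h (x i)\<bar>)" if "i < n" for i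
      using that f h by (intro integrable_PiM_component[where f = "\<lambda>y. \<bar>f y - h y\<bar>"]) auto
    have "P.prob ?V \<le> P.expectation (\<lambda>x. \<Sum>i<n. \<bar>f (x i) - h (x i)\<bar>) / (real n * (d / 3))"
      using int \<open>0 < d\<close> elim
      by (intro integral_Markov_inequality_measure[where A = "{}"]) (auto intro!: sum_nonneg)
    also have "P.expectation (\<lambda>x. \<Sum>i<n. \<bar>f (x i) - h (x i)\<bar>)
        = real n * expectation (\<lambda>y. \<bar>f y - h y\<bar>)"
      using int f h
      by (simp add: integral_PiM_component[where f = "\<lambda>y. \<bar>f y - h y\<bar>"])
    also have "\<dots> / (real n * (d / 3)) < e / 2"
      using close \<open>0 < d\<close> elim by (simp add: field_simps)
    finally have V: "P.prob ?V < e / 2" .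
    have "{x \<in> space ?P. \<bar>(\<Sum>i<n. f (x i)) / real n - expectation f\<bar> > d} \<subseteq> ?U \<union> ?V"
    proof (rule subsetI, rule ccontr)
      fix x assume x: "x \<in> {x \<in> space ?P. \<bar>(\<Sum>i<n. f (x i)) / real n - expectation f\<bar> > d}"
        and "x \<notin> ?U \<union> ?V"
      then have *: "\<bar>(\<Sum>i<n. h (x i)) - real n * expectation h\<bar> < real n * (d / 3)"
        "(\<Sum>i<n. \<bar>f (x i) - h (x i)\<bar>) < real n * (d / 3)" by auto
      have "\<bar>(\<Sum>i<n. f (x i)) - (\<Sum>i<n. h (x i))\<bar> \<le> (\<Sum>i<n. \<bar>f (x i) - h (x i)\<bar>)"
        by (simp add: sum_subtractf[symmetric] sum_abs)
      moreover have "\<bar>real n * expectation f - real n * expectation h\<bar> \<le> real n * (d / 3)"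
        using Ediff close elim by (simp add: right_diff_distrib[symmetric] abs_mult)
      ultimately have lt: "\<bar>(\<Sum>i<n. f (x i)) - real n * expectation f\<bar> < real n * d"
        using * by linarith
      have "(\<Sum>i<n. f (x i)) - real n * expectation f
          = real n * ((\<Sum>i<n. f (x i)) / real n - expectation f)"
        using elim by (simp add: field_simps)
      then have "real n * \<bar>(\<Sum>i<n. f (x i)) / real n - expectation f\<bar> < real n * d"
        using lt by (simp add: abs_mult)
      then show False using x elim by simp
    qed
    then have "P.prob {x \<in> space ?P. \<bar>(\<Sum>i<n. f (x i)) / real n - expectation f\<bar> > d}
        \<le> P.prob (?U \<union> ?V)"
      by (intro P.finite_measure_mono) auto
    also have "\<dots> \<le> P.prob ?U + P.prob ?V"
      by (intro measure_Un_le) auto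
    finally show ?case using U V by linarith
  qed
qed

text \<open>With sigma-finite factors the product measure is determined by its values on boxes. On a
  box the indicator factors over the coordinates, and so does the integral.\<close>

lemma PiM_density:
  fixes g :: "'a \<Rightarrow> ennreal"
  assumes "sigma_finite_measure N" "sigma_finite_measure (density N g)"
    "g \<in> borel_measurable N" "finite I"
  shows "PiM I (\<lambda>_. density N g) = density (PiM I (\<lambda>_. N)) (\<lambda>x. \<Prod>i\<in>I. g (x i))"
proof -
  interpret N: product_sigma_finite "\<lambda>_. N" by (simp add: assms product_sigma_finite_def)
  interpret D: product_sigma_finite "\<lambda>_. density N g" by (simp add: assms product_sigma_finite_def)
  have [measurable]: "g \<in> borel_measurable N" by fact
  show ?thesis
  proof (rule D.PiM_eqI[symmetric])
    fix A assume A: "\<And>i. i \<in> I \<Longrightarrow> A i \<in> sets (density N g)"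
    then have [measurable]: "\<And>i. i \<in> I \<Longrightarrow> A i \<in> sets N" by simp
    have AP: "Pi\<^sub>E I A \<in> sets (PiM I (\<lambda>_. N))"
      using A \<open>finite I\<close> by (intro sets_PiM_I_finite) auto
    have "emeasure (density (PiM I (\<lambda>_. N)) (\<lambda>x. \<Prod>i\<in>I. g (x i))) (Pi\<^sub>E I A)
        = (\<integral>\<^sup>+x. (\<Prod>i\<in>I. g (x i)) * indicator (Pi\<^sub>E I A) x \<partial>PiM I (\<lambda>_. N))"
      using AP by (intro emeasure_density) auto
    also have "\<dots> = (\<integral>\<^sup>+x. (\<Prod>i\<in>I. g (x i) * indicator (A i) (x i)) \<partial>PiM I (\<lambda>_. N))"
    proof (rule nn_integral_cong)
      fix x assume "x \<in> space (PiM I (\<lambda>_. N))"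
      then have "indicator (Pi\<^sub>E I A) x = (\<Prod>i\<in>I. indicator (A i) (x i) :: ennreal)"
        using \<open>finite I\<close> by (auto simp: indicator_def space_PiM PiE_iff prod_zero_iff)
      then show "(\<Prod>i\<in>I. g (x i)) * indicator (Pi\<^sub>E I A) x
          = (\<Prod>i\<in>I. g (x i) * indicator (A i) (x i))"
        by (simp add: prod.distrib)
    qed
    also have "\<dots> = (\<Prod>i\<in>I. \<integral>\<^sup>+x. g x * indicator (A i) x \<partial>N)"
      using \<open>finite I\<close> by (intro N.product_nn_integral_prod) auto
    also have "\<dots> = (\<Prod>i\<in>I. emeasure (density N g) (A i))"
      by (intro prod.cong refl) (simp add: emeasure_density)
    finally show "emeasure (density (PiM I (\<lambda>_. N)) (\<lambda>x. \<Prod>i\<in>I. g (x i))) (Pi\<^sub>E I A)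
        = (\<Prod>i\<in>I. emeasure (density N g) (A i))" .
  qed (use \<open>finite I\<close> in \<open>auto intro!: sets_PiM_cong\<close>)
qed

section \<open>Extended logarithms, growth rates and typical sets\<close>

lemma eln_ennreal: "0 < r \<Longrightarrow> eln (ennreal r) = ereal (ln r)"
  by (simp add: eln_def ennreal_eq_0_iff)

lemma eln_0: "eln 0 = - \<infinity>"
  and eln_top: "eln \<top> = \<infinity>"
  by (simp_all add: eln_def)

text \<open>These equivalences include \<open>0\<close> and \<open>\<top>\<close>, so null sets,
  empty sets and infinite volumes need no separate treatment once rates are turned into exponential
  bounds.\<close>

lemma
  shows eln_le_iff: "eln x \<le> ereal c \<longleftrightarrow> x \<le> ennreal (exp c)"
    and le_eln_iff: "ereal c \<le> eln x \<longleftrightarrow> ennreal (exp c) \<le> x"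
proof -
  consider "x = 0" | r where "0 < r" "x = ennreal r" | "x = \<top>"
    by (cases x) (auto simp: less_le)
  note x = this
  from x show "eln x \<le> ereal c \<longleftrightarrow> x \<le> ennreal (exp c)"
  proof cases
    case (2 r)
    then show ?thesis using exp_le_cancel_iff[of "ln r" c] by (simp add: eln_ennreal)
  next
    case 3
    then show ?thesis
      using ennreal_less_top[of "exp c"] unfolding not_le[symmetric] by (simp add: eln_top)
  qed (simp add: eln_0)
  from x show "ereal c \<le> eln x \<longleftrightarrow> ennreal (exp c) \<le> x"
  proof cases
    case 1
    then show ?thesis
      using exp_gt_zero[of c] by (simp add: eln_0 ennreal_eq_0_iff)
  next
    case (2 r)
    then show ?thesis using exp_le_cancel_iff[of c "ln r"] by (simp add: eln_ennreal)
  qed (simp add: eln_top)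
qed

lemma
  assumes "1 \<le> n"
  shows rate_le_iff: "ereal (1 / real n) * eln x \<le> ereal c \<longleftrightarrow> x \<le> ennreal (exp (real n * c))"
    and le_rate_iff: "ereal c \<le> ereal (1 / real n) * eln x \<longleftrightarrow> ennreal (exp (real n * c)) \<le> x"
proof -
  have n: "0 < real n" using assms by simp
  have "ereal (1 / real n) * eln x \<le> ereal c \<longleftrightarrow> eln x \<le> ereal (real n * c)"
    using n by (cases "eln x") (auto simp: field_simps)
  then show "ereal (1 / real n) * eln x \<le> ereal c \<longleftrightarrow> x \<le> ennreal (exp (real n * c))"
    by (simp add: eln_le_iff)
  have "ereal c \<le> ereal (1 / real n) * eln x \<longleftrightarrow> ereal (real n * c) \<le> eln x"
    using n by (cases "eln x") (auto simp: field_simps)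
  then show "ereal c \<le> ereal (1 / real n) * eln x \<longleftrightarrow> ennreal (exp (real n * c)) \<le> x"
    by (simp add: le_eln_iff)
qed

lemma
  assumes "1 \<le> n"
  shows growth_rate_le_iff: "growth_rate n S \<le> ereal c \<longleftrightarrow> real (card S) \<le> exp (real n * c)"
    and le_growth_rate_iff: "ereal c \<le> growth_rate n S \<longleftrightarrow> exp (real n * c) \<le> real (card S)"
  by (simp_all only: growth_rate_def rate_le_iff[OF assms] le_rate_iff[OF assms]
      ennreal_of_nat_eq_real_of_nat ennreal_le_iff of_nat_0_le_iff exp_ge_zero)

text \<open>A vanishing product has extended logarithm \<open>-\<infinity>\<close>, hence infinite
  distance from the entropy. Making this exclusion explicit allows the real \<open>ln\<close> in the
  remaining condition.\<close>

lemma weakly_typical_iff: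
  assumes "1 \<le> n"
  shows "x \<in> weakly_typical \<nu> \<sigma> g n \<delta> \<longleftrightarrow>
    x \<in> space (PiM {..<n} (\<lambda>_. \<nu>)) \<and> 0 < (\<Prod>i<n. g (x i)) \<and>
    \<bar>- ln (\<Prod>i<n. g (x i)) / real n - entropy_wrt \<nu> \<sigma>\<bar> \<le> \<delta>"
proof (cases "0 < (\<Prod>i<n. g (x i))")
  case True
  then have "ennreal (\<Prod>i<n. g (x i)) \<noteq> 0" by (simp add: ennreal_eq_0_iff del: prod_zero_iff)
  with True show ?thesis by (simp add: weakly_typical_def eln_def del: prod_zero_iff)
next
  case False
  then have "ennreal (\<Prod>i<n. g (x i)) = 0" by (simp add: ennreal_eq_0_iff)
  with False assms show ?thesis by (simp add: weakly_typical_def eln_def)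
qed

lemma
  assumes "1 \<le> n" "x \<in> weakly_typical \<nu> \<sigma> g n \<delta>"
  shows weakly_typical_lower: "exp (- (real n * (entropy_wrt \<nu> \<sigma> + \<delta>))) \<le> (\<Prod>i<n. g (x i))"
    and weakly_typical_upper: "(\<Prod>i<n. g (x i)) \<le> exp (- (real n * (entropy_wrt \<nu> \<sigma> - \<delta>)))"
proof -
  let ?p = "\<Prod>i<n. g (x i)" and ?H = "entropy_wrt \<nu> \<sigma>"
  have p: "0 < ?p" and *: "\<bar>- ln ?p / real n - ?H\<bar> \<le> \<delta>"
    using assms by (auto simp: weakly_typical_iff)
  have n: "0 < real n" using assms by simp
  have "- (real n * (?H + \<delta>)) \<le> ln ?p" "ln ?p \<le> - (real n * (?H - \<delta>))"
    using * n by (simp_all add: abs_le_iff field_simps)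
  then have "exp (- (real n * (?H + \<delta>))) \<le> exp (ln ?p)" "exp (ln ?p) \<le> exp (- (real n * (?H - \<delta>)))"
    by (simp_all del: exp_ln)
  with p show "exp (- (real n * (?H + \<delta>))) \<le> ?p" "?p \<le> exp (- (real n * (?H - \<delta>)))"
    by simp_all
qed

section \<open>The mixture and its reference measure\<close>

text \<open>Only the data of \<open>\<rho>\<close> are fixed here; the word sets and
  \<open>\<epsilon>\<close> stay variable, so that the counting lemmas apply to different families
  of words.\<close>

locale mixture = prob_space \<rho> for \<rho> :: "'a measure" +
  fixes k :: nat and E :: "nat \<Rightarrow> 'a set" and m :: "nat \<Rightarrow> 'a measure" and g :: "'a \<Rightarrow> real"
  assumes decomp: "piecewise_continuous_decomp \<rho> k E m"
    and space_eq: "space \<rho> = (\<Union>i\<in>{1..k}. E i)"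
    and version: "density_version (ref_measure \<rho> k m) \<rho> g"
    and finite_entropy: "entropy_finite (ref_measure \<rho> k m) \<rho>"
begin

abbreviation "\<mu> \<equiv> ref_measure \<rho> k m"
abbreviation "q \<equiv> weight \<rho> E"
abbreviation "HY \<equiv> label_entropy \<rho> k E"
abbreviation "HX \<equiv> entropy_wrt \<mu> \<rho>"
abbreviation "P (n::nat) \<equiv> PiM {..<n} (\<lambda>_. \<rho>)"
abbreviation "Q (n::nat) \<equiv> PiM {..<n} (\<lambda>_. label_measure \<rho> k E)"
abbreviation "words (n::nat) \<equiv> PiE {..<n} (\<lambda>_. {1..k})"

lemma
  shows E_sets [measurable]: "i \<in> {1..k} \<Longrightarrow> E i \<in> sets \<rho>"
    and E_disjoint: "i \<in> {1..k} \<Longrightarrow> j \<in> {1..k} \<Longrightarrow> i \<noteq> j \<Longrightarrow> E i \<inter> E j = {}"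
    and sets_m: "i \<in> {1..k} \<Longrightarrow> sets (m i) = sets \<rho>"
    and sigma_finite_m: "i \<in> {1..k} \<Longrightarrow> sigma_finite_measure (m i)"
    and m_restr: "i \<in> {1..k} \<Longrightarrow> m i = restr_measure (m i) (E i)"
    and weight_pos: "i \<in> {1..k} \<Longrightarrow> 0 < q i"
proof -
  note d = decomp[unfolded piecewise_continuous_decomp_def]
  show "i \<in> {1..k} \<Longrightarrow> E i \<in> sets \<rho>"
    by (rule bspec[OF d[THEN conjunct2, THEN conjunct2, THEN conjunct1]])
  show "i \<in> {1..k} \<Longrightarrow> j \<in> {1..k} \<Longrightarrow> i \<noteq> j \<Longrightarrow> E i \<inter> E j = {}"
    by (rule disjoint_family_onD[OF d[THEN conjunct2, THEN conjunct1]])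
  note d' = d[THEN conjunct2, THEN conjunct2, THEN conjunct2]
  show "i \<in> {1..k} \<Longrightarrow> sets (m i) = sets \<rho>" "i \<in> {1..k} \<Longrightarrow> sigma_finite_measure (m i)"
    using d'[THEN conjunct1] by simp_all
  show "i \<in> {1..k} \<Longrightarrow> m i = restr_measure (m i) (E i)"
    by (rule bspec[OF d'[THEN conjunct2, THEN conjunct1]])
  show "i \<in> {1..k} \<Longrightarrow> 0 < q i"
    using d'[THEN conjunct2, THEN conjunct2, THEN conjunct1]
    by (simp add: weight_def emeasure_eq_measure)
qed

lemma sets_ref [simp, measurable_cong]: "sets \<mu> = sets \<rho>"
  by (simp add: ref_measure_def)

lemma space_ref [simp]: "space \<mu> = space \<rho>"
  by (simp add: ref_measure_def)

lemma emeasure_m_Int: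
  assumes "i \<in> {1..k}" "B \<in> sets \<rho>"
  shows "emeasure (m i) (E i \<inter> B) = emeasure (m i) B"
proof -
  have "emeasure (m i) B = emeasure (restr_measure (m i) (E i)) B"
    using m_restr[OF assms(1)] by simp
  also have "\<dots> = emeasure (m i) (E i \<inter> B)"
    unfolding restr_measure_def using assms by (intro emeasure_restricted) (auto simp: sets_m)
  finally show ?thesis by simp
qed

text \<open>Every other \<open>m j\<close> is concentrated on \<open>E j\<close>, which is disjoint
  from \<open>E i\<close>, so a single summand of the reference measure survives.\<close>

lemma emeasure_ref_Int:
  assumes "i \<in> {1..k}" "B \<in> sets \<rho>"
  shows "emeasure \<mu> (E i \<inter> B) = emeasure (m i) B"
proof -
  have B: "E i \<inter> B \<in> sets \<rho>" using assms by auto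
  have zero: "emeasure (m j) (E i \<inter> B) = 0" if "j \<in> {1..k} - {i}" for j
  proof -
    have "emeasure (m j) (E i \<inter> B) = emeasure (m j) (E j \<inter> (E i \<inter> B))"
      using that B by (simp add: emeasure_m_Int)
    also have "E j \<inter> (E i \<inter> B) = {}" using E_disjoint[of j i] that assms by auto
    finally show ?thesis by simp
  qed
  have "emeasure \<mu> (E i \<inter> B) = (\<Sum>j\<in>{1..k}. emeasure (m j) (E i \<inter> B))"
    unfolding ref_measure_def using B by (intro emeasure_sum_measure) (auto simp: sets_m)
  also have "\<dots> = emeasure (m i) (E i \<inter> B)"
    using assms zero by (subst sum.remove[of _ i]) (auto intro!: sum.neutral)
  finally show ?thesis using assms by (simp add: emeasure_m_Int)
qed

text \<open>This turns integrals over a single piece into integrals over \<open>\<mu>\<close> with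
  an indicator, the form in which the pieces can be added up.\<close>

lemma m_eq_density:
  assumes "i \<in> {1..k}"
  shows "m i = density \<mu> (indicator (E i))"
proof (rule measure_eqI)
  fix B assume "B \<in> sets (m i)"
  then show "emeasure (m i) B = emeasure (density \<mu> (indicator (E i))) B"
    using assms by (simp add: sets_m emeasure_restricted emeasure_ref_Int)
qed (use assms in \<open>simp add: sets_m\<close>)

text \<open>A set of finite \<open>m i\<close> measure may be infinite for another
  \<open>m j\<close>. Cutting each covering set of \<open>m i\<close> down to \<open>E i\<close>
  removes those contributions, and the pieces together still cover the space.\<close>

lemma sigma_finite_ref: "sigma_finite_measure \<mu>"
proof
  have "\<exists>C. countable C \<and> C \<subseteq> sets (m i) \<and> \<Union>C = space (m i) \<and> (\<forall>a\<in>C. emeasure (m i) a \<noteq> \<infinity>)"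
    if "i \<in> {1..k}" for i
    using sigma_finite_measure.sigma_finite_countable[OF sigma_finite_m[OF that]] by blast
  then obtain C where C: "\<And>i. i \<in> {1..k} \<Longrightarrow> countable (C i)" "\<And>i. i \<in> {1..k} \<Longrightarrow> C i \<subseteq> sets (m i)"
    "\<And>i. i \<in> {1..k} \<Longrightarrow> \<Union>(C i) = space (m i)"
    "\<And>i a. i \<in> {1..k} \<Longrightarrow> a \<in> C i \<Longrightarrow> emeasure (m i) a \<noteq> \<infinity>"
    by metis
  let ?D = "\<Union>i\<in>{1..k}. (\<inter>) (E i) ` C i"
  show "\<exists>D. countable D \<and> D \<subseteq> sets \<mu> \<and> \<Union>D = space \<mu> \<and> (\<forall>a\<in>D. emeasure \<mu> a \<noteq> \<infinity>)"
  proof (intro exI[of _ ?D] conjI)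
    show "countable ?D" using C by auto
    show "?D \<subseteq> sets \<mu>" using C(2) by (fastforce simp: sets_m)
    have "\<Union>((\<inter>) (E i) ` C i) = E i" if "i \<in> {1..k}" for i
      using C(3)[OF that] sets_eq_imp_space_eq[OF sets_m[OF that]]
        sets.sets_into_space[OF E_sets[OF that]] by auto
    then have "(\<Union>i\<in>{1..k}. \<Union>((\<inter>) (E i) ` C i)) = (\<Union>i\<in>{1..k}. E i)"
      by (intro SUP_cong refl)
    then have "\<Union>?D = (\<Union>i\<in>{1..k}. E i)"
      by (subst (asm) UN_UN_flatten[where C = "\<lambda>x. x", unfolded image_ident, symmetric]) simp
    then show "\<Union>?D = space \<mu>" by (simp add: space_eq)
    show "\<forall>a\<in>?D. emeasure \<mu> a \<noteq> \<infinity>"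
    proof
      fix a assume "a \<in> ?D"
      then obtain i b where i: "i \<in> {1..k}" "b \<in> C i" "a = E i \<inter> b" by auto
      then have "b \<in> sets \<rho>" using C(2) sets_m by blast
      then show "emeasure \<mu> a \<noteq> \<infinity>" using i C(4) by (simp add: emeasure_ref_Int)
    qed
  qed
qed

section \<open>The density and the chain rule for entropy\<close>

lemma g_measurable [measurable]: "g \<in> borel_measurable \<rho>"
  and g_nonneg: "x \<in> space \<rho> \<Longrightarrow> 0 \<le> g x"
  and density_g: "density \<mu> (\<lambda>x. ennreal (g x)) = \<rho>"
proof -
  have "g \<in> borel_measurable \<mu>" using version by (simp add: density_version_def)
  then show "g \<in> borel_measurable \<rho>" using measurable_cong_sets[OF sets_ref refl] by blast
qed (use version in \<open>auto simp: density_version_def\<close>)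

text \<open>The zero set of \<open>g\<close> has no mass under the measure with density
  \<open>g\<close>. This keeps points of vanishing density out of all statements about
  logarithms.\<close>

lemma g_pos_AE: "AE x in \<rho>. 0 < g x"
proof -
  have "AE x in density \<mu> (\<lambda>x. ennreal (g x)). 0 < g x"
    by (subst AE_density) auto
  then show ?thesis unfolding density_g .
qed

lemma integrable_g: "integrable \<mu> g"
  and integral_g_E: "i \<in> {1..k} \<Longrightarrow> (\<integral>x. indicator (E i) x * g x \<partial>\<mu>) = q i"
proof -
  have "integrable (density \<mu> g) (\<lambda>_. 1 :: real)" by (simp add: density_g)
  then show "integrable \<mu> g"
    by (subst (asm) integrable_density) (auto simp: g_nonneg)
  assume i: "i \<in> {1..k}"
  have "q i = (\<integral>x. indicator (E i) x \<partial>density \<mu> g)"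
    using i by (simp add: density_g weight_def)
  also have "\<dots> = (\<integral>x. indicator (E i) x * g x \<partial>\<mu>)"
    using i by (subst integral_density) (auto simp: g_nonneg mult.commute)
  finally show "(\<integral>x. indicator (E i) x * g x \<partial>\<mu>) = q i" by simp
qed

lemma integrable_g_ln_g: "integrable \<mu> (\<lambda>x. g x * ln (g x))"
  and HX_eq: "HX = - (\<integral>x. g x * ln (g x) \<partial>\<mu>)"
  using entropy_finite_version[OF sigma_finite_ref version] finite_entropy
    entropy_wrt_version[OF sigma_finite_ref version] by simp_all

text \<open>Moving the factor \<open>g\<close> into the measure turns finite entropy into a first
  moment of \<open>ln g\<close> under \<open>\<rho>\<close>, which is the input of the weak
  law.\<close>

lemma integrable_ln_g: "integrable \<rho> (\<lambda>x. ln (g x))"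
  and expectation_ln_g: "expectation (\<lambda>x. ln (g x)) = - HX"
proof -
  have "integrable (density \<mu> g) (\<lambda>x. ln (g x))"
    using integrable_g_ln_g by (subst integrable_density) (auto simp: g_nonneg)
  then show "integrable \<rho> (\<lambda>x. ln (g x))" by (simp add: density_g)
  have "(\<integral>x. ln (g x) \<partial>density \<mu> g) = (\<integral>x. g x * ln (g x) \<partial>\<mu>)"
    by (subst integral_density) (auto simp: g_nonneg)
  then show "expectation (\<lambda>x. ln (g x)) = - HX" by (simp add: density_g HX_eq)
qed

text \<open>No cutoff to \<open>E i\<close> appears in the density: \<open>m i\<close> is
  \<open>\<mu>\<close> restricted to \<open>E i\<close>, so the base measure already discards the
  rest of the space.\<close>

lemma component_density_version:
  assumes i: "i \<in> {1..k}"
  shows "density_version (m i) (component \<rho> E i) (\<lambda>x. g x / q i)"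
  unfolding density_version_def
proof (intro conjI ballI)
  have q: "0 < q i" using i by (rule weight_pos)
  have [measurable_cong]: "sets (m i) = sets \<rho>" using i by (rule sets_m)
  show "(\<lambda>x. g x / q i) \<in> borel_measurable (m i)" by measurable
  show "0 \<le> g x / q i" if "x \<in> space (m i)" for x
    using that q sets_eq_imp_space_eq[OF sets_m[OF i]] by (simp add: g_nonneg)
  show "density (m i) (\<lambda>x. ennreal (g x / q i)) = component \<rho> E i"
  proof (rule measure_eqI)
    fix B assume "B \<in> sets (density (m i) (\<lambda>x. ennreal (g x / q i)))"
    then have [measurable]: "B \<in> sets \<rho>" using i by (simp add: sets_m)
    have [measurable]: "E i \<in> sets \<rho>" using i by (rule E_sets)
    have "emeasure (density (m i) (\<lambda>x. ennreal (g x / q i))) B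
        = (\<integral>\<^sup>+x. ennreal (g x / q i) * indicator B x \<partial>m i)"
      using i by (intro emeasure_density) (auto simp: sets_m)
    also have "\<dots> = (\<integral>\<^sup>+x. ennreal (g x / q i) * indicator B x \<partial>density \<mu> (indicator (E i)))"
      using m_eq_density[OF i] by simp
    also have "\<dots> = (\<integral>\<^sup>+x. indicator (E i) x * (ennreal (g x / q i) * indicator B x) \<partial>\<mu>)"
      by (intro nn_integral_density) auto
    also have "\<dots> = (\<integral>\<^sup>+x. ennreal (g x) * indicator (E i \<inter> B) x / ennreal (q i) \<partial>\<mu>)"
      using q by (intro nn_integral_cong) (auto simp: g_nonneg divide_ennreal split: split_indicator)
    also have "\<dots> = (\<integral>\<^sup>+x. ennreal (g x) * indicator (E i \<inter> B) x \<partial>\<mu>) / ennreal (q i)"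
      by (intro nn_integral_divide) auto
    also have "(\<integral>\<^sup>+x. ennreal (g x) * indicator (E i \<inter> B) x \<partial>\<mu>) = emeasure (density \<mu> g) (E i \<inter> B)"
      by (intro emeasure_density[symmetric]) auto
    also have "\<dots> / ennreal (q i) = emeasure (component \<rho> E i) B"
      by (simp add: density_g component_def weight_def emeasure_eq_measure)
    finally show "emeasure (density (m i) (\<lambda>x. ennreal (g x / q i))) B = emeasure (component \<rho> E i) B" .
  qed (use i in \<open>simp add: sets_m component_def\<close>)
qed

lemma weighted_component_entropy:
  assumes i: "i \<in> {1..k}"
  shows "q i * entropy_wrt (m i) (component \<rho> E i)
    = q i * ln (q i) - (\<integral>x. indicator (E i) x * (g x * ln (g x)) \<partial>\<mu>)"
proof -
  have q: "0 < q i" using i by (rule weight_pos)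
  have [measurable]: "E i \<in> sets \<rho>" using i by (rule E_sets)
  have int: "integrable \<mu> (\<lambda>x. indicator (E i) x * (g x * ln (g x)))"
    "integrable \<mu> (\<lambda>x. indicator (E i) x * g x)"
    using integrable_real_mult_indicator[OF _ integrable_g_ln_g, of "E i"]
      integrable_real_mult_indicator[OF _ integrable_g, of "E i"] by (simp_all add: mult.commute)
  have "entropy_wrt (m i) (component \<rho> E i) = - (\<integral>x. g x / q i * ln (g x / q i) \<partial>m i)"
    using i by (intro entropy_wrt_version sigma_finite_m component_density_version)
  also have "(\<integral>x. g x / q i * ln (g x / q i) \<partial>m i)
      = (\<integral>x. g x / q i * ln (g x / q i) \<partial>density \<mu> (\<lambda>x. ennreal (indicator (E i) x)))"
    using m_eq_density[OF i] by (simp add: ennreal_indicator)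
  also have "\<dots> = (\<integral>x. indicator (E i) x * (g x / q i * ln (g x / q i)) \<partial>\<mu>)"
    by (subst integral_density) auto
  also have "\<dots> = (\<integral>x. (indicator (E i) x * (g x * ln (g x))
      - ln (q i) * (indicator (E i) x * g x)) / q i \<partial>\<mu>)"
  proof (intro Bochner_Integration.integral_cong refl)
    fix x assume "x \<in> space \<mu>"
    then have "0 \<le> g x" by (simp add: g_nonneg)
    then show "indicator (E i) x * (g x / q i * ln (g x / q i))
        = (indicator (E i) x * (g x * ln (g x)) - ln (q i) * (indicator (E i) x * g x)) / q i"
      \<comment> \<open>Where \<open>g\<close> vanishes both sides are \<open>0\<close>; elsewhere
        the logarithm of the quotient splits.\<close>
      using q by (cases "g x = 0") (auto simp: ln_div field_simps split: split_indicator)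
  qed
  also have "\<dots> = ((\<integral>x. indicator (E i) x * (g x * ln (g x)) \<partial>\<mu>) - ln (q i) * q i) / q i"
    using int i by (simp add: integral_g_E)
  finally show ?thesis using q by (simp add: field_simps)
qed

text \<open>Summing the weighted component entropies, the terms \<open>q i * ln (q i)\<close> add up
  to \<open>- HY\<close>, and the integrals over the pieces add up to \<open>- HX\<close> because
  the pieces partition the space.\<close>

lemma entropy_chain_rule: "HX = HY + cond_entropy \<rho> k E m"
proof -
  have int: "integrable \<mu> (\<lambda>x. indicator (E i) x * (g x * ln (g x)))" if "i \<in> {1..k}" for i
    using integrable_real_mult_indicator[OF _ integrable_g_ln_g, of "E i"] E_sets[OF that]
    by (simp add: mult.commute)
  have one: "(\<Sum>i=1..k. indicator (E i) x) = (1::real)" if x: "x \<in> space \<rho>" for x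
  proof -
    obtain j where j: "j \<in> {1..k}" "x \<in> E j" using x space_eq by auto
    then have "indicator (E i) x = (0::real)" if "i \<in> {1..k} - {j}" for i
      using E_disjoint[of i j] that by (auto simp: indicator_def)
    with j show ?thesis by (subst sum.remove[of _ j]) auto
  qed
  have "(\<integral>x. g x * ln (g x) \<partial>\<mu>) = (\<integral>x. (\<Sum>i=1..k. indicator (E i) x * (g x * ln (g x))) \<partial>\<mu>)"
    by (intro Bochner_Integration.integral_cong refl)
      (simp only: sum_distrib_right[symmetric] space_ref one mult_1_left)
  also have "\<dots> = (\<Sum>i=1..k. \<integral>x. indicator (E i) x * (g x * ln (g x)) \<partial>\<mu>)"
    using int by (intro Bochner_Integration.integral_sum) auto
  finally have "HX = - (\<Sum>i=1..k. \<integral>x. indicator (E i) x * (g x * ln (g x)) \<partial>\<mu>)"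
    by (simp add: HX_eq)
  then show ?thesis
    by (simp add: label_entropy_def cond_entropy_def weighted_component_entropy sum_subtractf)
qed

section \<open>Words of labels and their fibers\<close>

abbreviation "word_weight (n::nat) y \<equiv> \<Prod>i<n. q (y i)"
abbreviation "fiber (n::nat) y \<equiv> {x \<in> space (P n). (\<lambda>i\<in>{..<n}. label k E (x i)) = y}"

lemma label_eq:
  assumes "i \<in> {1..k}" "x \<in> E i"
  shows "label k E x = i"
  unfolding label_def using assms E_disjoint[of _ i] by (intro the_equality) blast+

lemma label_vimage: "i \<in> {1..k} \<Longrightarrow> label k E -` {i} \<inter> space \<rho> = E i"
  using label_eq by (auto simp: space_eq)

lemma label_measurable: "label k E \<in> measurable \<rho> (count_space {1..k})"
proof (subst measurable_count_space_eq2, simp, intro conjI ballI)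
  show "label k E \<in> space \<rho> \<rightarrow> {1..k}"
    using label_eq by (force simp: space_eq)
  show "label k E -` {i} \<inter> space \<rho> \<in> sets \<rho>" if "i \<in> {1..k}" for i
    unfolding label_vimage[OF that] using that by (rule E_sets)
qed

lemma sets_label_measure [simp]: "sets (label_measure \<rho> k E) = Pow {1..k}"
  and space_label_measure [simp]: "space (label_measure \<rho> k E) = {1..k}"
  by (simp_all add: label_measure_def)

lemma emeasure_label_measure:
  "i \<in> {1..k} \<Longrightarrow> emeasure (label_measure \<rho> k E) {i} = ennreal (q i)"
  unfolding label_measure_def
  by (subst emeasure_distr[OF label_measurable]) (simp, simp only: label_vimage weight_def emeasure_eq_measure)

lemma prob_space_label_measure: "prob_space (label_measure \<rho> k E)"
  unfolding label_measure_def using label_measurable by (rule prob_space_distr)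

lemma label_density_version: "density_version (count_space {1..k}) (label_measure \<rho> k E) q"
proof -
  have "density (count_space {1..k}) (\<lambda>i. ennreal (q i)) = label_measure \<rho> k E"
  proof (rule measure_eqI_finite[where A = "{1..k}"])
    fix i assume i: "i \<in> {1..k}"
    then show "emeasure (density (count_space {1..k}) (\<lambda>i. ennreal (q i))) {i}
        = emeasure (label_measure \<rho> k E) {i}"
      unfolding emeasure_label_measure[OF i]
      by (simp add: emeasure_density nn_integral_indicator_singleton)
  qed auto
  then show ?thesis by (simp add: density_version_def weight_def)
qed

lemma label_entropy_wrt: "entropy_wrt (count_space {1..k}) (label_measure \<rho> k E) = HY"
proof -
  have "sigma_finite_measure (count_space {1..k})"
    by (intro sigma_finite_measure_count_space_finite) simp
  from entropy_wrt_version[OF this label_density_version]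
  show ?thesis by (simp add: lebesgue_integral_count_space_finite label_entropy_def)
qed

lemma
  assumes "1 \<le> n" "y \<in> label_typical \<rho> k E n d"
  shows label_typical_word: "y \<in> words n"
    and label_typical_lower: "exp (- (real n * (HY + d))) \<le> word_weight n y"
    and label_typical_upper: "word_weight n y \<le> exp (- (real n * (HY - d)))"
proof -
  show "y \<in> words n"
    using assms(2) by (simp add: label_typical_def weakly_typical_def space_PiM)
  note y = assms(2)[unfolded label_typical_def]
  show "exp (- (real n * (HY + d))) \<le> word_weight n y"
    using weakly_typical_lower[OF assms(1) y] unfolding label_entropy_wrt .
  show "word_weight n y \<le> exp (- (real n * (HY - d)))"
    using weakly_typical_upper[OF assms(1) y] unfolding label_entropy_wrt .
qed

lemma finite_words: "finite (words n)"
  by (intro finite_PiE) auto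

lemma word_weight_nonneg: "0 \<le> word_weight n y"
  by (intro prod_nonneg) (simp add: weight_def)

text \<open>The \<open>n\<close>-th power of the total weight 1, expanded by distributivity.\<close>

lemma sum_word_weight: "(\<Sum>y\<in>words n. word_weight n y) = 1"
proof -
  have "(\<Sum>i\<in>{1..k}. q i) = prob (\<Union>i\<in>{1..k}. E i)"
    unfolding weight_def
    by (rule finite_measure_finite_Union[symmetric])
      (use E_sets E_disjoint in \<open>auto simp: disjoint_family_on_def\<close>)
  also have "\<dots> = 1" unfolding space_eq[symmetric] by (rule prob_space)
  finally have "(\<Sum>i\<in>{1..k}. q i) = 1" .
  then have "(\<Prod>j<n. \<Sum>i\<in>{1..k}. q i) = 1" by simp
  then show ?thesis by (subst (asm) prod_sum_PiE) auto
qed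

lemma word_nth: "y \<in> words n \<Longrightarrow> i < n \<Longrightarrow> y i \<in> {1..k}"
  by (rule PiE_mem[of y "{..<n}" "\<lambda>_. {1..k}"]) simp_all

lemma prod_ennreal_weight: "(\<Prod>i<n. ennreal (q (y i))) = ennreal (word_weight n y)"
  unfolding weight_def by (rule prod_ennreal[OF measure_nonneg])

lemma word_singleton: "y \<in> words n \<Longrightarrow> {y} = PiE {..<n} (\<lambda>i. {y i})"
  by (subst PiE_singleton) (simp_all add: PiE_iff)

lemma
  assumes y: "y \<in> words n"
  shows sets_Q_singleton: "{y} \<in> sets (Q n)"
    and measure_Q_singleton: "measure (Q n) {y} = word_weight n y"
proof -
  interpret L: prob_space "label_measure \<rho> k E" by (rule prob_space_label_measure)
  interpret L: product_prob_space "\<lambda>_. label_measure \<rho> k E" by unfold_locales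
  have yk: "{y i} \<in> sets (label_measure \<rho> k E)" if "i \<in> {..<n}" for i
    using word_nth[OF y, of i] that by simp
  show "{y} \<in> sets (Q n)"
    by (subst word_singleton[OF y], rule sets_PiM_I_finite[OF finite_lessThan yk])
  have "emeasure (Q n) {y} = (\<Prod>i<n. emeasure (label_measure \<rho> k E) {y i})"
    by (subst word_singleton[OF y], rule L.emeasure_PiM[OF finite_lessThan yk])
  also have "\<dots> = (\<Prod>i<n. ennreal (q (y i)))"
    by (rule prod.cong[OF refl]) (rule emeasure_label_measure[OF word_nth[OF y]], simp)
  also have "\<dots> = ennreal (word_weight n y)"
    by (rule prod_ennreal_weight)
  finally show "measure (Q n) {y} = word_weight n y"
    by (rule measure_eq_emeasure_eq_ennreal[OF word_weight_nonneg])
qed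

lemma measure_Q:
  assumes "S \<subseteq> words n"
  shows "measure (Q n) S = (\<Sum>y\<in>S. word_weight n y)"
proof -
  interpret Q: prob_space "Q n" by (intro prob_space_PiM prob_space_label_measure)
  have "measure (Q n) S = (\<Sum>y\<in>S. measure (Q n) {y})"
    by (rule Q.finite_measure_eq_sum_singleton[OF finite_subset[OF assms finite_words]])
      (rule sets_Q_singleton[OF subsetD[OF assms]])
  also have "\<dots> = (\<Sum>y\<in>S. word_weight n y)"
    by (rule sum.cong[OF refl]) (rule measure_Q_singleton[OF subsetD[OF assms]])
  finally show ?thesis .
qed

text \<open>Each point lies in exactly one piece, so prescribing all labels prescribes the piece of
  every coordinate. As a box the fiber is measurable and its mass is a product.\<close>

lemma fiber_eq:
  assumes y: "y \<in> words n"
  shows "fiber n y = PiE {..<n} (\<lambda>i. E (y i))"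
proof (intro equalityI subsetI)
  fix x assume x: "x \<in> fiber n y"
  then have *: "x \<in> PiE {..<n} (\<lambda>_. space \<rho>)" and y_eq: "(\<lambda>i\<in>{..<n}. label k E (x i)) = y"
    by (simp_all only: space_PiM mem_Collect_eq)
  have "x i \<in> E (y i)" if "i < n" for i
  proof -
    have "x i \<in> space \<rho>" using * that by (simp add: PiE_iff)
    then obtain j where j: "j \<in> {1..k}" "x i \<in> E j" by (auto simp: space_eq)
    moreover have "label k E (x i) = y i" using fun_cong[OF y_eq, of i] that by simp
    ultimately show ?thesis using label_eq[OF j] by simp
  qed
  with * show "x \<in> PiE {..<n} (\<lambda>i. E (y i))" by (auto simp: PiE_iff)
next
  fix x assume x: "x \<in> PiE {..<n} (\<lambda>i. E (y i))"
  note yk = word_nth[OF y]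
  have "x i \<in> space \<rho>" if "i < n" for i
    using x yk[OF that] that by (auto simp: space_eq PiE_iff)
  moreover have "label k E (x i) = y i" if "i < n" for i
    using x yk[OF that] that by (intro label_eq) (auto simp: PiE_iff)
  ultimately show "x \<in> fiber n y"
    using x y by (auto simp: space_PiM PiE_iff extensional_def fun_eq_iff)
qed

text \<open>Together with \<open>measure_Q_singleton\<close> this identifies the mass of a fiber
  under \<open>P n\<close> with that of its word under \<open>Q n\<close>, without computing the
  image of \<open>P n\<close> under the componentwise label map.\<close>

lemma
  assumes y: "y \<in> words n"
  shows fiber_sets: "fiber n y \<in> sets (P n)"
    and measure_fiber: "measure (P n) (fiber n y) = word_weight n y"
proof -
  interpret L: product_prob_space "\<lambda>_. \<rho>" by unfold_locales
  have Ey: "E (y i) \<in> sets \<rho>" if "i \<in> {..<n}" for i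
    using E_sets[OF word_nth[OF y, of i]] that by simp
  show "fiber n y \<in> sets (P n)"
    by (subst fiber_eq[OF y], rule sets_PiM_I_finite[OF finite_lessThan Ey])
  have "emeasure (P n) (fiber n y) = (\<Prod>i<n. emeasure \<rho> (E (y i)))"
    by (subst fiber_eq[OF y], rule L.emeasure_PiM[OF finite_lessThan Ey])
  also have "\<dots> = (\<Prod>i<n. ennreal (q (y i)))"
    unfolding emeasure_eq_measure weight_def ..
  also have "\<dots> = ennreal (word_weight n y)"
    by (rule prod_ennreal_weight)
  finally show "measure (P n) (fiber n y) = word_weight n y"
    by (rule measure_eq_emeasure_eq_ennreal[OF word_weight_nonneg])
qed

section \<open>Equipartition and the density bound on typical sets\<close>

lemma prob_space_P: "prob_space (P n)"
  by (intro prob_space_PiM prob_space_axioms)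

lemma typical_sets:
  assumes "1 \<le> n"
  shows "weakly_typical \<mu> \<rho> g n d \<in> sets (P n)"
proof -
  have sp: "space (PiM {..<n} (\<lambda>_. \<mu>)) = space (P n)" by (simp add: space_PiM)
  have "weakly_typical \<mu> \<rho> g n d = {x \<in> space (P n). 0 < (\<Prod>i<n. g (x i)) \<and>
      \<bar>- ln (\<Prod>i<n. g (x i)) / real n - HX\<bar> \<le> d}"
    using weakly_typical_iff[OF assms, of _ \<mu> \<rho> g d] unfolding sp by auto
  also have "\<dots> \<in> sets (P n)" by measurable
  finally show ?thesis .
qed

lemma asymptotic_equipartition:
  assumes "0 < d" "0 < e"
  shows "\<forall>\<^sub>F n in sequentially. measure (P n) (weakly_typical \<mu> \<rho> g n d) > 1 - e"
  using weak_law_of_large_numbers_PiM[OF integrable_ln_g assms] eventually_ge_at_top[of 1]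
proof eventually_elim
  case (elim n)
  interpret P: prob_space "P n" by (rule prob_space_P)
  have n: "0 < real n" using elim by simp
  let ?V = "{x \<in> space (P n). \<bar>(\<Sum>i<n. ln (g (x i))) / real n - expectation (\<lambda>x. ln (g x))\<bar> > d}"
  have sp: "space (PiM {..<n} (\<lambda>_. \<mu>)) = space (P n)" by (simp add: space_PiM)
  \<comment> \<open>If some \<open>g (x i)\<close> is \<open>0\<close>, the typical set excludes
    \<open>x\<close>, whereas the sum of logarithms silently uses \<open>ln 0 = 0\<close>. Off this
    null event typicality is exactly the absence of a deviation larger than
    \<open>d\<close>.\<close>
  have "AE x in P n. \<forall>i\<in>{..<n}. 0 < g (x i)"
    by (intro AE_finite_allI AE_PiM_component prob_space_axioms g_pos_AE) auto
  then have "AE x in P n. x \<in> weakly_typical \<mu> \<rho> g n d \<longleftrightarrow> x \<in> space (P n) - ?V"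
  proof (rule AE_mp, intro AE_I2 impI)
    fix x assume x: "x \<in> space (P n)" and pos: "\<forall>i\<in>{..<n}. 0 < g (x i)"
    have "0 < (\<Prod>i<n. g (x i))" using pos by (intro prod_pos) auto
    moreover have "ln (\<Prod>i<n. g (x i)) = (\<Sum>i<n. ln (g (x i)))"
      using pos by (intro ln_prod) (auto dest!: bspec)
    ultimately have "x \<in> weakly_typical \<mu> \<rho> g n d
        \<longleftrightarrow> \<bar>- (\<Sum>i<n. ln (g (x i))) / real n - HX\<bar> \<le> d"
      using x elim by (simp only: weakly_typical_iff sp) simp
    also have "\<dots> \<longleftrightarrow> x \<in> space (P n) - ?V"
      using x by (auto simp: expectation_ln_g abs_le_iff not_less)
    finally show "x \<in> weakly_typical \<mu> \<rho> g n d \<longleftrightarrow> x \<in> space (P n) - ?V" .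
  qed
  then have "P.prob (weakly_typical \<mu> \<rho> g n d) = P.prob (space (P n) - ?V)"
    using typical_sets elim by (intro P.finite_measure_eq_AE) auto
  also have "\<dots> = 1 - P.prob ?V" by (intro P.prob_compl) measurable
  finally show ?case using elim by simp
qed

text \<open>The product of the \<open>g (x i)\<close> is the density of \<open>P n\<close> with
  respect to the product of \<open>\<mu>\<close>, and typicality bounds it from above on
  \<open>S\<close>. With \<open>emeasure\<close> no finiteness of the volume has to be shown
  first.\<close>

lemma emeasure_typical_le:
  assumes n: "1 \<le> n" and S: "S \<in> sets (P n)" "S \<subseteq> weakly_typical \<mu> \<rho> g n d"
  shows "emeasure (P n) S
    \<le> ennreal (exp (- (real n * (HX - d)))) * emeasure (PiM {..<n} (\<lambda>_. \<mu>)) S"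
proof -
  have sP: "sets (PiM {..<n} (\<lambda>_. \<mu>)) = sets (P n)" by (intro sets_PiM_cong) auto
  have PD: "P n = density (PiM {..<n} (\<lambda>_. \<mu>)) (\<lambda>x. \<Prod>i<n. ennreal (g (x i)))"
    using PiM_density[OF sigma_finite_ref, of "\<lambda>x. ennreal (g x)" "{..<n}"] density_g
      sigma_finite_measure_axioms by simp
  have "emeasure (P n) S = (\<integral>\<^sup>+x. (\<Prod>i<n. ennreal (g (x i))) * indicator S x \<partial>PiM {..<n} (\<lambda>_. \<mu>))"
    by (subst PD, rule emeasure_density) (use S sP in auto)
  also have "\<dots> \<le> (\<integral>\<^sup>+x. ennreal (exp (- (real n * (HX - d)))) * indicator S x \<partial>PiM {..<n} (\<lambda>_. \<mu>))"
  proof (intro nn_integral_mono)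
    fix x assume x: "x \<in> space (PiM {..<n} (\<lambda>_. \<mu>))"
    then have "\<And>i. i < n \<Longrightarrow> 0 \<le> g (x i)" by (auto simp: space_PiM intro!: g_nonneg)
    then have "(\<Prod>i<n. ennreal (g (x i))) = ennreal (\<Prod>i<n. g (x i))"
      by (intro prod_ennreal) simp
    then show "(\<Prod>i<n. ennreal (g (x i))) * indicator S x
        \<le> ennreal (exp (- (real n * (HX - d)))) * indicator S x"
      using weakly_typical_upper[OF n, of x] S by (auto simp: indicator_def intro: ennreal_leI)
  qed
  also have "\<dots> = ennreal (exp (- (real n * (HX - d)))) * emeasure (PiM {..<n} (\<lambda>_. \<mu>)) S"
    using S sP by (intro nn_integral_cmult_indicator) auto
  finally show ?thesis .
qed

section \<open>Counting typical words and words with large fibers\<close>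

text \<open>Each typical word has at least the weight \<open>exp (- (n (HY + d)))\<close>, and all
  weights together amount to 1.\<close>

lemma card_le_of_label_typical:
  assumes n: "1 \<le> n" and S: "S \<subseteq> label_typical \<rho> k E n d"
  shows "real (card S) \<le> exp (real n * (HY + d))"
proof -
  let ?c = "exp (- (real n * (HY + d)))"
  have sub: "S \<subseteq> words n" using S label_typical_word[OF n] by blast
  have "real (card S) * ?c = (\<Sum>y\<in>S. ?c)" by simp
  also have "\<dots> \<le> (\<Sum>y\<in>S. word_weight n y)"
    using S label_typical_lower[OF n] by (intro sum_mono) blast
  also have "\<dots> \<le> (\<Sum>y\<in>words n. word_weight n y)"
    using sub by (intro sum_mono2 finite_words word_weight_nonneg)
  finally have "real (card S) * ?c \<le> 1" by (simp only: sum_word_weight)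
  then show ?thesis
    by (simp only: exp_minus divide_inverse[symmetric] pos_divide_le_eq[OF exp_gt_zero] mult_1_left)
qed

text \<open>No typical word weighs more than \<open>exp (- (n (HY - d)))\<close>, so a given
  probability forces many words.\<close>

lemma card_ge_of_label_typical:
  assumes n: "1 \<le> n" and S: "S \<subseteq> label_typical \<rho> k E n d"
  shows "measure (Q n) S * exp (real n * (HY - d)) \<le> real (card S)"
proof -
  let ?c = "exp (- (real n * (HY - d)))"
  have sub: "S \<subseteq> words n" using S label_typical_word[OF n] by blast
  have "measure (Q n) S = (\<Sum>y\<in>S. word_weight n y)" using sub by (rule measure_Q)
  also have "\<dots> \<le> (\<Sum>y\<in>S. ?c)"
    using S label_typical_upper[OF n] by (intro sum_mono) blast
  finally have "measure (Q n) S \<le> real (card S) * ?c" by simp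
  then show ?thesis
    by (simp only: exp_minus divide_inverse[symmetric] pos_le_divide_eq[OF exp_gt_zero])
qed

text \<open>In the lower bound one \<open>d\<close> comes from typicality; the second absorbs the
  factor \<open>1 / 2\<close>, because \<open>exp (- (n d))\<close> eventually drops below
  it.\<close>

lemma
  assumes "0 < d"
    and S: "\<And>n. 1 \<le> n \<Longrightarrow> S n \<subseteq> label_typical \<rho> k E n d"
    and half: "\<forall>\<^sub>F n in sequentially. 1 / 2 \<le> measure (Q n) (S n)"
  shows liminf_growth_rate_ge: "ereal (HY - 2 * d) \<le> liminf (\<lambda>n. growth_rate n (S n))"
    and limsup_growth_rate_le: "limsup (\<lambda>n. growth_rate n (S n)) \<le> ereal (HY + d)"
proof -
  have "(\<lambda>n. exp (- (real n * d))) \<longlonglongrightarrow> 0"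
    using \<open>0 < d\<close> by real_asymp
  then have "\<forall>\<^sub>F n in sequentially. exp (- (real n * d)) < 1 / 2"
    by (rule order_tendstoD) simp
  then have "\<forall>\<^sub>F n in sequentially. ereal (HY - 2 * d) \<le> growth_rate n (S n)"
    using half eventually_ge_at_top[of 1]
  proof eventually_elim
    case (elim n)
    have "exp (real n * (HY - 2 * d)) = exp (- (real n * d)) * exp (real n * (HY - d))"
      by (simp add: exp_add[symmetric] algebra_simps)
    also have "\<dots> \<le> measure (Q n) (S n) * exp (real n * (HY - d))"
      using elim by (intro mult_right_mono) auto
    also have "\<dots> \<le> real (card (S n))"
      using elim S by (intro card_ge_of_label_typical) auto
    finally show ?case using elim by (simp add: le_growth_rate_iff)
  qed
  then show "ereal (HY - 2 * d) \<le> liminf (\<lambda>n. growth_rate n (S n))"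
    by (rule Liminf_bounded)
  have "\<forall>\<^sub>F n in sequentially. growth_rate n (S n) \<le> ereal (HY + d)"
    using eventually_ge_at_top[of 1]
    by eventually_elim (simp add: growth_rate_le_iff card_le_of_label_typical S)
  then show "limsup (\<lambda>n. growth_rate n (S n)) \<le> ereal (HY + d)"
    by (rule Limsup_bounded)
qed

text \<open>On the typical set the density of \<open>\<rho>\<close> is at most \<open>exp (- n (HX - \<delta>))\<close>, so a fiber of small
  volume carries little mass. By the chain rule and the bound on the number of typical words, all
  small fibers together carry at most \<open>exp (n (2\<delta> + 2\<delta>' - \<epsilon>))\<close>.\<close>

lemma measure_large_fiber_words:
  assumes pos: "0 < \<epsilon>" "0 < \<delta>" "0 < \<delta>'" and small: "2 * \<delta> + 2 * \<delta>' < \<epsilon>"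
    and A: "\<And>n. 1 \<le> n \<Longrightarrow> A \<delta>' n \<subseteq> label_typical \<rho> k E n \<delta>'"
    and meas: "\<forall>\<^sub>F n in sequentially. 7 / 8 \<le> measure (Q n) (A \<delta>' n)"
  shows "\<forall>\<^sub>F n in sequentially.
    1 / 2 \<le> measure (Q n) (large_fiber_words \<rho> k E m g A \<epsilon> \<delta> \<delta>' n)"
proof -
  have "\<forall>\<^sub>F n in sequentially. measure (P n) (weakly_typical \<mu> \<rho> g n \<delta>) > 1 - 1 / 8"
    using pos by (intro asymptotic_equipartition) auto
  moreover have "(\<lambda>n. exp (- (real n * (\<epsilon> - 2 * \<delta> - 2 * \<delta>')))) \<longlonglongrightarrow> 0"
  proof -
    have "0 < \<epsilon> - 2 * \<delta> - 2 * \<delta>'" using small by simp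
    then show ?thesis by real_asymp
  qed
  then have "\<forall>\<^sub>F n in sequentially. exp (- (real n * (\<epsilon> - 2 * \<delta> - 2 * \<delta>'))) < 1 / 4"
    by (rule order_tendstoD) simp
  ultimately show ?thesis using meas eventually_ge_at_top[of 1]
  proof eventually_elim
    case (elim n)
    then have n: "1 \<le> n" by simp
    interpret P: prob_space "P n" by (rule prob_space_P)
    define S where "S = A \<delta>' n"
    define B where "B = large_fiber_words \<rho> k E m g A \<epsilon> \<delta> \<delta>' n"
    define W where "W = weakly_typical \<mu> \<rho> g n \<delta>"
    define F where "F = fiber n"
    have S: "S \<subseteq> label_typical \<rho> k E n \<delta>'" using A[OF n] by (simp add: S_def)
    have Sw: "S \<subseteq> words n" using S label_typical_word[OF n] by blast
    have finS: "finite S" using Sw finite_words by (rule finite_subset)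
    have BS: "B \<subseteq> S" by (auto simp: B_def S_def large_fiber_words_def)
    have W: "W \<in> sets (P n)" unfolding W_def using n by (rule typical_sets)
    have F: "F y \<in> sets (P n)" "P.prob (F y) = word_weight n y" if "y \<in> S" for y
      unfolding F_def using fiber_sets measure_fiber subsetD[OF Sw that] by blast+
    have disj: "disjoint_family_on F S" "disjoint_family_on (\<lambda>y. F y \<inter> W) S"
      by (auto simp: disjoint_family_on_def F_def)
    have "P.prob (\<Union>y\<in>S. F y) = (\<Sum>y\<in>S. P.prob (F y))"
      using finS F disj by (intro P.finite_measure_finite_Union) auto
    also have "\<dots> = measure (Q n) S"
      using F by (simp add: measure_Q[OF Sw])
    finally have PF: "P.prob (\<Union>y\<in>S. F y) \<ge> 7 / 8" using elim by (simp add: S_def)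
    have U: "(\<Union>y\<in>S. F y) \<in> sets (P n)" using finS F by auto
    \<comment> \<open>Two events of probability at least \<open>7 / 8\<close> meet in probability at
      least \<open>3 / 4\<close>. Removing at most \<open>1 / 4\<close> for the small fibers leaves
      the claimed \<open>1 / 2\<close>.\<close>
    have "P.prob (\<Union>y\<in>S. F y) + P.prob W
        = P.prob ((\<Union>y\<in>S. F y) \<union> W) + P.prob ((\<Union>y\<in>S. F y) \<inter> W)"
      using P.finite_measure_Union'[OF U W] P.finite_measure_Diff'[OF W U] by (simp add: Int_commute)
    moreover have "P.prob ((\<Union>y\<in>S. F y) \<union> W) \<le> 1" by simp
    moreover have "P.prob ((\<Union>y\<in>S. F y) \<inter> W) = (\<Sum>y\<in>S. P.prob (F y \<inter> W))"
    proof -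
      have "(\<Union>y\<in>S. F y) \<inter> W = (\<Union>y\<in>S. F y \<inter> W)" by blast
      then show ?thesis
        using finS F W disj by (simp only:) (intro P.finite_measure_finite_Union, auto)
    qed
    moreover have "(\<Sum>y\<in>S. P.prob (F y \<inter> W))
        = (\<Sum>y\<in>S - B. P.prob (F y \<inter> W)) + (\<Sum>y\<in>B. P.prob (F y \<inter> W))"
      using finS BS by (rule sum.subset_diff[rotated])
    moreover have "(\<Sum>y\<in>B. P.prob (F y \<inter> W)) \<le> measure (Q n) B"
    proof -
      have "(\<Sum>y\<in>B. P.prob (F y \<inter> W)) \<le> (\<Sum>y\<in>B. word_weight n y)"
      proof (rule sum_mono)
        fix y assume "y \<in> B"
        then have "y \<in> S" using BS by blast
        then show "P.prob (F y \<inter> W) \<le> word_weight n y"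
          using P.finite_measure_mono[of "F y \<inter> W" "F y"] F by simp
      qed
      also have "\<dots> = measure (Q n) B"
        using BS Sw by (intro measure_Q[symmetric]) blast
      finally show ?thesis .
    qed
    moreover have "(\<Sum>y\<in>S - B. P.prob (F y \<inter> W)) \<le> 1 / 4"
    proof -
      let ?h = "cond_entropy \<rho> k E m - \<epsilon> + \<delta> + \<delta>'"
      let ?c = "exp (- (real n * (HX - \<delta>))) * exp (real n * ?h)"
      have bound: "P.prob (F y \<inter> W) \<le> ?c" if y: "y \<in> S - B" for y
      proof -
        have T: "fiber_typical \<rho> k E m g n \<delta> y = F y \<inter> W"
          by (simp add: fiber_typical_def F_def W_def)
        \<comment> \<open>The negated strict inequality also covers fibers of volume
          \<open>0\<close>, whose rate is \<open>-\<infinity>\<close>.\<close>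
        have "emeasure (PiM {..<n} (\<lambda>_. \<mu>)) (F y \<inter> W) \<le> ennreal (exp (real n * ?h))"
          using y unfolding B_def S_def large_fiber_words_def T[symmetric]
          by (simp add: not_less rate_le_iff[OF n])
        then have "ennreal (exp (- (real n * (HX - \<delta>)))) * emeasure (PiM {..<n} (\<lambda>_. \<mu>)) (F y \<inter> W)
            \<le> ennreal (exp (- (real n * (HX - \<delta>)))) * ennreal (exp (real n * ?h))"
          by (rule mult_left_mono) simp
        moreover have "emeasure (P n) (F y \<inter> W)
            \<le> ennreal (exp (- (real n * (HX - \<delta>)))) * emeasure (PiM {..<n} (\<lambda>_. \<mu>)) (F y \<inter> W)"
          using F W y by (intro emeasure_typical_le[OF n]) (auto simp: W_def)
        ultimately have "emeasure (P n) (F y \<inter> W) \<le> ennreal ?c"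
          by (simp only: ennreal_mult' exp_ge_zero)
        then show ?thesis by (simp add: P.emeasure_eq_measure)
      qed
      have "(\<Sum>y\<in>S - B. P.prob (F y \<inter> W)) \<le> (\<Sum>y\<in>S - B. ?c)"
        using bound by (rule sum_mono)
      also have "\<dots> = real (card (S - B)) * ?c" by simp
      also have "\<dots> \<le> exp (real n * (HY + \<delta>')) * ?c"
        using S by (intro mult_right_mono card_le_of_label_typical n) auto
      \<comment> \<open>Here \<open>HX = HY + cond_entropy \<rho> k E m\<close> cancels the
        entropies. One \<open>\<delta>\<close> comes from the density and one from the volume
        threshold; one \<open>\<delta>'\<close> comes from that threshold and one from the number of
        words.\<close>
      also have "\<dots> = exp (- (real n * (\<epsilon> - 2 * \<delta> - 2 * \<delta>')))"
        by (simp add: entropy_chain_rule exp_add[symmetric] algebra_simps)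
      finally show ?thesis using elim by linarith
    qed
    moreover have "P.prob W > 7 / 8" using elim by (simp add: W_def)
    ultimately have "1 / 2 \<le> measure (Q n) B" using PF by linarith
    then show ?case by (simp add: B_def)
  qed
qed

end

section \<open>Passage to the limit\<close>

text \<open>A limit determines the \<open>Limsup\<close> only along a nontrivial filter. The point
  \<open>(e / 4, e / 4)\<close> lies in the open quadrant at distance at most \<open>e / 2\<close>
  from the origin.\<close>

lemma quadrant_nontrivial: "at (0, 0) within {0<..} \<times> {0<..} \<noteq> (bot :: (real \<times> real) filter)"
proof -
  have "(0, 0) islimpt ({0<..} \<times> {0<..} :: (real \<times> real) set)"
    unfolding islimpt_approachable
  proof (intro allI impI)
    fix e :: real assume e: "0 < e"
    have "dist (e / 4, e / 4) (0, 0) \<le> \<bar>e / 4\<bar> + \<bar>e / 4\<bar>"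
      unfolding dist_Pair_Pair dist_real_def diff_0_right power2_abs by (rule sqrt_sum_squares_le_sum_abs)
    also have "\<dots> < e" using e by simp
    finally have "dist (e / 4, e / 4) (0, 0) < e" .
    then show "\<exists>p\<in>{0<..} \<times> {0<..}. p \<noteq> (0 :: real, 0 :: real) \<and> dist p (0, 0) < e"
      using e by (intro bexI[of _ "(e / 4, e / 4)"]) auto
  qed
  then show ?thesis by (simp add: trivial_limit_within)
qed

theorem proposition4:
  fixes \<rho> :: "'a measure" and k :: nat and E :: "nat \<Rightarrow> 'a set" and m :: "nat \<Rightarrow> 'a measure"
    and g :: "'a \<Rightarrow> real" and A :: "real \<Rightarrow> nat \<Rightarrow> (nat \<Rightarrow> nat) set" and \<epsilon> :: real
  assumes "prob_space \<rho>"
    and "piecewise_continuous_decomp \<rho> k E m"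
    and "space \<rho> = (\<Union>i\<in>{1..k}. E i)"
    and "density_version (ref_measure \<rho> k m) \<rho> g"
    and "entropy_finite (ref_measure \<rho> k m) \<rho>"
    and "\<And>\<delta>' n. 0 < \<delta>' \<Longrightarrow> 1 \<le> n \<Longrightarrow> A \<delta>' n \<subseteq> label_typical \<rho> k E n \<delta>'"
    and "\<And>\<delta>' \<eta>. 0 < \<delta>' \<Longrightarrow> 0 < \<eta> \<Longrightarrow>
           \<forall>\<^sub>F n in sequentially.
             measure (PiM {..<n} (\<lambda>_. label_measure \<rho> k E)) (A \<delta>' n) \<ge> 1 - \<eta>"
    and "0 < \<epsilon>"
  shows "Limsup (at (0, 0) within {0<..} \<times> {0<..})
           (\<lambda>(\<delta>, \<delta>'). limsup (\<lambda>n. growth_rate n (large_fiber_words \<rho> k E m g A \<epsilon> \<delta> \<delta>' n)))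
         = ereal (label_entropy \<rho> k E)
       \<and> ((\<lambda>\<delta>'. liminf (\<lambda>n. growth_rate n (A \<delta>' n))) \<longlongrightarrow> ereal (label_entropy \<rho> k E)) (at_right 0)
       \<and> ((\<lambda>\<delta>'. limsup (\<lambda>n. growth_rate n (A \<delta>' n))) \<longlongrightarrow> ereal (label_entropy \<rho> k E)) (at_right 0)"
proof (intro conjI)
  interpret mixture \<rho> k E m g
    using assms by (simp add: mixture_def mixture_axioms_def)
  have meas: "\<forall>\<^sub>F n in sequentially. 7 / 8 \<le> measure (Q n) (A d n)" if "0 < d" for d
    using assms(7)[OF that, of "1 / 8"] by simp
  have half: "\<forall>\<^sub>F n in sequentially. 1 / 2 \<le> measure (Q n) (A d n)" if "0 < d" for d
    using meas[OF that] by eventually_elim simp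
  note bounds = liminf_growth_rate_ge[where S = "A d" for d, OF _ assms(6) half]
    limsup_growth_rate_le[where S = "A d" for d, OF _ assms(6) half]
  have le: "liminf (\<lambda>n. growth_rate n (A d n)) \<le> limsup (\<lambda>n. growth_rate n (A d n))" for d
    by (rule Liminf_le_Limsup) simp
  have pos: "\<forall>\<^sub>F d in at_right 0. 0 < (d::real)"
    by (rule eventually_at_right_less)
  have low: "((\<lambda>d. ereal (HY - 2 * d)) \<longlongrightarrow> ereal HY) (at_right 0)"
    by (auto intro!: tendsto_eq_intros)
  have high: "((\<lambda>d. ereal (HY + d)) \<longlongrightarrow> ereal HY) (at_right 0)"
    by (auto intro!: tendsto_eq_intros)
  show "((\<lambda>\<delta>'. liminf (\<lambda>n. growth_rate n (A \<delta>' n))) \<longlongrightarrow> ereal HY) (at_right 0)"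
    by (rule tendsto_sandwich[OF _ _ low high]; use pos in eventually_elim)
      (use bounds le order_trans in blast)+
  show "((\<lambda>\<delta>'. limsup (\<lambda>n. growth_rate n (A \<delta>' n))) \<longlongrightarrow> ereal HY) (at_right 0)"
    by (rule tendsto_sandwich[OF _ _ low high]; use pos in eventually_elim)
      (use bounds le order_trans in blast)+
  let ?F = "at (0, 0) within {0<..} \<times> {0<..} :: (real \<times> real) filter"
  let ?G = "\<lambda>(\<delta>, \<delta>'). limsup (\<lambda>n. growth_rate n (large_fiber_words \<rho> k E m g A \<epsilon> \<delta> \<delta>' n))"
  \<comment> \<open>The lower bound passes through the liminf over \<open>n\<close>, which lies
    below the limsup; the condition on \<open>p\<close> makes the small fibers negligible.\<close>
  have B: "ereal (HY - 2 * snd p) \<le> ?G p \<and> ?G p \<le> ereal (HY + snd p)"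
    if p: "0 < fst p" "0 < snd p" "2 * fst p + 2 * snd p < \<epsilon>" for p
  proof -
    let ?B = "large_fiber_words \<rho> k E m g A \<epsilon> (fst p) (snd p)"
    have sub: "?B n \<subseteq> label_typical \<rho> k E n (snd p)" if "1 \<le> n" for n
      using assms(6)[OF p(2) that] by (auto simp: large_fiber_words_def)
    have half: "\<forall>\<^sub>F n in sequentially. 1 / 2 \<le> measure (Q n) (?B n)"
      by (rule measure_large_fiber_words[where A = A, OF assms(8) p assms(6)[OF p(2)] meas[OF p(2)]])
    have "ereal (HY - 2 * snd p) \<le> liminf (\<lambda>n. growth_rate n (?B n))"
      by (rule liminf_growth_rate_ge[where S = ?B, OF p(2) sub half])
    also have "\<dots> \<le> limsup (\<lambda>n. growth_rate n (?B n))"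
      by (rule Liminf_le_Limsup) simp
    finally show ?thesis
      using limsup_growth_rate_le[where S = ?B, OF p(2) sub half] by (simp add: case_prod_beta)
  qed
  have fs: "(fst \<longlongrightarrow> 0) ?F" "(snd \<longlongrightarrow> 0) ?F"
    using tendsto_fst[OF tendsto_ident_at, of "(0, 0)"] tendsto_snd[OF tendsto_ident_at, of "(0, 0)"]
    by simp_all
  have "((\<lambda>p. 2 * fst p + 2 * snd p) \<longlongrightarrow> 0) ?F"
    using fs by (auto intro!: tendsto_eq_intros)
  then have "\<forall>\<^sub>F p in ?F. 2 * fst p + 2 * snd p < \<epsilon>"
    by (rule order_tendstoD) (rule assms(8))
  moreover have "\<forall>\<^sub>F p in ?F. p \<in> {0<..} \<times> {0<..}"
    by (simp add: eventually_at_filter)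
  ultimately have ev: "\<forall>\<^sub>F p in ?F. ereal (HY - 2 * snd p) \<le> ?G p \<and> ?G p \<le> ereal (HY + snd p)"
    by eventually_elim (rule B, auto)
  \<comment> \<open>The squeeze gives a genuine limit as both widths tend to 0 jointly, and the
    \<open>Limsup\<close> is read off from it.\<close>
  have "(?G \<longlongrightarrow> ereal HY) ?F"
  proof (rule tendsto_sandwich)
    show "\<forall>\<^sub>F p in ?F. ereal (HY - 2 * snd p) \<le> ?G p" "\<forall>\<^sub>F p in ?F. ?G p \<le> ereal (HY + snd p)"
      using ev by (auto elim: eventually_mono)
    show "((\<lambda>p. ereal (HY - 2 * snd p)) \<longlongrightarrow> ereal HY) ?F" "((\<lambda>p. ereal (HY + snd p)) \<longlongrightarrow> ereal HY) ?F"
      using fs by (auto intro!: tendsto_eq_intros)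
  qed
  with quadrant_nontrivial show "Limsup ?F ?G = ereal HY"
    by (rule lim_imp_Limsup)
qed

end
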